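(* There is a number $s_1\in(1.03,1.04)$ such that $I(a,b)\le\lambda_s(a,b)\le A(a,b)$ for all $a,b>0$ whenever $s_1\le s\le 2$. These bounds are best possible: the inequality $I(a,b)\le \lambda_s(a,b)$ holds for all $a,b>0$ if and only if $s\ge s_1$, and the inequality $\lambda_s(a,b)\le A(a,b)$ holds for all $a,b>0$ if and only if $s\le 2$.
   Context: For $a,b>0$ with $a\neq b$ define $$\lambda_s(a,b)=\begin{cases}\dfrac{s-1}{s+1}\cdot\dfrac{a^{s+1}+b^{s+1}-2\left(\frac{a+b}{2}\right)^{s+1}}{a^s+b^s-2\left(\frac{a+b}{2}\right)^s}, & s\in\mathbb{R}\setminus\{-1,0,1\},\\[3mm] \dfrac{2\log\frac{a+b}{2}-\log a-\log b}{\frac{1}{2a}+\frac{1}{2b}-\frac{2}{a+b}}, & s=-1,\\[3mm] \dfrac{a\log a+b\log b-(a+b)\log\frac{a+b}{2}}{2\log\frac{a+b}{2}-\log a-\log b}, & s=0,\\[3mm] \dfrac{(b-a)^2}{4\left(a\log a+b\log b-(a+b)\log\frac{a+b}{2}\right)}, & s=1,\end{cases}$$ and $\lambda_s(a,a)=a$. The identric mean is $I(a,b)=\frac1e\,(b^b/a^a)^{1/(b-a)}$ for $a\ne b$, $I(a,a)=a$, and the arithmetic mean is $A(a,b)=(a+b)/2$. *)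

theory Defs
  imports "HOL-Analysis.Analysis"
begin

definition lambda_mean :: "real \<Rightarrow> real \<Rightarrow> real \<Rightarrow> real" where
  "lambda_mean s a b =
    (if a = b then a
     else if s = -1 then
       (2 * ln ((a + b) / 2) - ln a - ln b) / (1 / (2 * a) + 1 / (2 * b) - 2 / (a + b))
     else if s = 0 then
       (a * ln a + b * ln b - (a + b) * ln ((a + b) / 2)) / (2 * ln ((a + b) / 2) - ln a - ln b)
     else if s = 1 then
       (b - a)^2 / (4 * (a * ln a + b * ln b - (a + b) * ln ((a + b) / 2)))
     else
       (s - 1) / (s + 1) *
       ((a powr (s + 1) + b powr (s + 1) - 2 * ((a + b) / 2) powr (s + 1)) /
        (a powr s + b powr s - 2 * ((a + b) / 2) powr s)))"

definition identric_mean :: "real \<Rightarrow> real \<Rightarrow> real" where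
  "identric_mean a b =
    (if a = b then a
     else (1 / exp 1) * ((b powr b / a powr a) powr (1 / (b - a))))"

definition arith_mean :: "real \<Rightarrow> real \<Rightarrow> real" where
  "arith_mean a b = (a + b) / 2"

end

theory Submission
  imports Defs
begin

text \<open>
  Write \<open>\<phi>\<^sub>s\<close> for the function with second derivative \<open>t powr (s - 2)\<close> and \<open>J\<^sub>s(a, b)\<close> for
  its Jensen gap, so that \<open>\<lambda>\<^sub>s = J\<^sub>s\<^sub>+\<^sub>1 / J\<^sub>s\<close>. This ratio is increasing in \<open>s\<close>, and \<open>\<lambda>\<^sub>2\<close> is the
  arithmetic mean, which gives the upper bound for \<open>s \<le> 2\<close>; for \<open>s > 2\<close> it fails as \<open>a \<rightarrow> 0\<close>.

  The set of \<open>s\<close> with \<open>I \<le> \<lambda>\<^sub>s\<close> is upward closed by monotonicity and closed under limits from the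
  right, so it is \<open>[s\<^sub>1, \<infinity>)\<close> for its infimum \<open>s\<^sub>1\<close>. Letting \<open>a \<rightarrow> 0\<close> shows that it does not contain
  \<open>1.03\<close>. It remains to see that it contains \<open>209/201 < 1.04\<close>. For \<open>a = 1 - x\<close>, \<open>b = 1 + x\<close> and
  \<open>z = x\<^sup>2\<close> the claim compares the power series of \<open>J\<^sub>s\<close>, \<open>J\<^sub>s\<^sub>+\<^sub>1\<close> and \<open>1/I\<close> in \<open>z\<close>. The margin at
  \<open>z = 1\<close> is only about \<open>0.001\<close> while the series converge slowly there, so about 500 terms matter;
  the high ones are compared through explicit bounds decaying like \<open>1/n\<^sup>2\<close>.
\<close>

section \<open>Jensen gaps and monotonicity in the exponent\<close>

definition pow_convex :: "real \<Rightarrow> real \<Rightarrow> real" where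
  "pow_convex s t =
    (if s = 0 then - ln t else if s = 1 then t * ln t else t powr s / (s * (s - 1)))"

definition pow_convex_deriv :: "real \<Rightarrow> real \<Rightarrow> real" where
  "pow_convex_deriv s t = (if s = 1 then ln t + 1 else t powr (s - 1) / (s - 1))"

text \<open>The normalisation of \<^term>\<open>pow_convex s\<close> makes its second derivative
  \<open>t powr (s - 2)\<close> for every \<open>s\<close>, so that all four cases of \<^const>\<open>lambda_mean\<close>
  become \<open>jensen_gap (s + 1) / jensen_gap s\<close>.\<close>

definition jensen_gap :: "real \<Rightarrow> real \<Rightarrow> real \<Rightarrow> real" where
  "jensen_gap s a b = pow_convex s a + pow_convex s b - 2 * pow_convex s ((a + b) / 2)"

lemma DERIV_pow_convex:
  assumes "0 < t"
  shows "(pow_convex s has_real_derivative pow_convex_deriv s t) (at t)"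
proof -
  consider "s = 0" | "s = 1" | "s \<noteq> 0" "s \<noteq> 1" by blast
  then show ?thesis
  proof cases
    case 1
    have "((\<lambda>t. - ln t) has_real_derivative - (1 / t)) (at t)"
      using assms by (auto intro!: derivative_eq_intros simp: field_simps)
    then show ?thesis
      using assms 1 by (simp add: pow_convex_def[abs_def] pow_convex_deriv_def powr_minus divide_inverse)
  next
    case 2
    have "((\<lambda>t. t * ln t) has_real_derivative ln t + 1) (at t)"
      using assms by (auto intro!: derivative_eq_intros simp: field_simps)
    then show ?thesis
      using 2 by (simp add: pow_convex_def[abs_def] pow_convex_deriv_def)
  next
    case 3
    have "((\<lambda>t. t powr s / (s * (s - 1))) has_real_derivative (s * t powr (s - 1)) / (s * (s - 1))) (at t)"
      using assms by (intro DERIV_cdivide has_real_derivative_powr)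
    then show ?thesis
      using 3 by (simp add: pow_convex_def[abs_def] pow_convex_deriv_def)
  qed
qed

lemma DERIV_pow_convex_deriv:
  assumes "0 < t"
  shows "(pow_convex_deriv s has_real_derivative t powr (s - 2)) (at t)"
proof (cases "s = 1")
  case True
  have "((\<lambda>t. ln t + 1) has_real_derivative 1 / t) (at t)"
    using assms by (auto intro!: derivative_eq_intros simp: field_simps)
  then show ?thesis
    using True assms by (simp add: pow_convex_deriv_def[abs_def] powr_minus divide_inverse)
next
  case False
  have "((\<lambda>t. t powr (s - 1) / (s - 1)) has_real_derivative ((s - 1) * t powr (s - 1 - 1)) / (s - 1)) (at t)"
    using assms by (intro DERIV_cdivide has_real_derivative_powr)
  then show ?thesis
    using False by (simp add: pow_convex_deriv_def[abs_def])
qed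

text \<open>The combination of the functions \<open>pow_convex (r i)\<close> has the sum in the last
  hypothesis as second derivative, so it is convex between \<open>a\<close> and \<open>b\<close>.
  Comparisons of Jensen gaps thereby become pointwise inequalities between powers.\<close>

lemma jensen_gap_lincomb_nonneg:
  assumes "0 < a" "0 < b" "finite I"
    and "\<And>t. min a b \<le> t \<Longrightarrow> t \<le> max a b \<Longrightarrow> 0 \<le> (\<Sum>i\<in>I. w i * t powr (r i - 2))"
  shows "0 \<le> (\<Sum>i\<in>I. w i * jensen_gap (r i) a b)"
proof -
  define f where "f = (\<lambda>t. \<Sum>i\<in>I. w i * pow_convex (r i) t)"
  have "convex_on {min a b..max a b} f"
  proof (rule f''_ge0_imp_convex)
    fix t assume t: "t \<in> {min a b..max a b}"
    then have "0 < t" using assms(1,2) by auto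
    then show "(f has_real_derivative (\<Sum>i\<in>I. w i * pow_convex_deriv (r i) t)) (at t)"
      unfolding f_def by (intro DERIV_sum DERIV_cmult DERIV_pow_convex)
    show "((\<lambda>t. \<Sum>i\<in>I. w i * pow_convex_deriv (r i) t) has_real_derivative
            (\<Sum>i\<in>I. w i * t powr (r i - 2))) (at t)"
      using \<open>0 < t\<close> by (intro DERIV_sum DERIV_cmult DERIV_pow_convex_deriv)
    show "0 \<le> (\<Sum>i\<in>I. w i * t powr (r i - 2))"
      using t assms(4) by auto
  qed auto
  from convex_onD[OF this, of "1/2" a b] have "f ((a + b) / 2) \<le> f a / 2 + f b / 2"
    by (simp add: add_divide_distrib)
  then have "0 \<le> f a + f b - 2 * f ((a + b) / 2)"
    by simp
  also have "\<dots> = (\<Sum>i\<in>I. w i * jensen_gap (r i) a b)"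
    by (simp add: f_def jensen_gap_def sum.distrib sum_subtractf sum_distrib_left algebra_simps)
  finally show ?thesis .
qed

lemma jensen_gap_two:
  assumes "0 < a" "0 < b"
  shows "jensen_gap 2 a b = ((b - a) / 2)\<^sup>2"
proof -
  have "jensen_gap 2 a b = a\<^sup>2 / 2 + b\<^sup>2 / 2 - 2 * (((a + b) / 2)\<^sup>2 / 2)"
    using assms by (simp add: jensen_gap_def pow_convex_def)
  also have "\<dots> = ((b - a) / 2)\<^sup>2"
    by (simp add: power2_eq_square field_split_simps)
  finally show ?thesis .
qed

text \<open>On the interval \<open>t powr (s - 2)\<close> has a positive lower bound
  \<open>k\<close>, attained at an endpoint. Hence the gap is at least \<open>k\<close> times the
  gap of exponent 2, which is an explicit square.\<close>

lemma jensen_gap_pos: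
  assumes "0 < a" "0 < b" "a \<noteq> b"
  shows "0 < jensen_gap s a b"
proof -
  define k where "k = min (a powr (s - 2)) (b powr (s - 2))"
  have "0 < k" using assms by (simp add: k_def)
  have "k \<le> t powr (s - 2)" if "min a b \<le> t" "t \<le> max a b" for t
  proof (cases "s \<ge> 2")
    case True
    then have "min a b powr (s - 2) \<le> t powr (s - 2)"
      using that assms by (intro powr_mono2) auto
    then show ?thesis by (auto simp: k_def min_def split: if_splits)
  next
    case False
    then have "max a b powr (s - 2) \<le> t powr (s - 2)"
      using that assms by (intro powr_mono2') auto
    then show ?thesis by (auto simp: k_def max_def min_def split: if_splits)
  qed
  moreover have "0 < t" if "min a b \<le> t" for t using that assms by auto
  ultimately have "0 \<le> (\<Sum>i\<in>{True,False}. (if i then 1 else - k) * jensen_gap (if i then s else 2) a b)"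
    using assms by (intro jensen_gap_lincomb_nonneg) auto
  then have "k * jensen_gap 2 a b \<le> jensen_gap s a b" by simp
  moreover have "0 < jensen_gap 2 a b" using assms by (simp add: jensen_gap_two)
  ultimately show ?thesis using \<open>0 < k\<close> by (meson less_le_trans mult_pos_pos)
qed

text \<open>In the generic case the normalising factors \<open>r * (r - 1)\<close> at
  \<open>r = s\<close> and \<open>r = s + 1\<close> produce the quotient
  \<open>(s - 1) / (s + 1)\<close>. The exceptional exponents are those for which \<open>s\<close>
  or \<open>s + 1\<close> is 0 or 1.\<close>

lemma lambda_mean_eq_jensen_gap:
  assumes "0 < a" "0 < b" "a \<noteq> b"
  shows "lambda_mean s a b = jensen_gap (s + 1) a b / jensen_gap s a b"
proof -
  consider "s = -1" | "s = 0" | "s = 1" | "s \<noteq> -1" "s \<noteq> 0" "s \<noteq> 1" by blast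
  then show ?thesis
  proof cases
    case 1
    have "jensen_gap 0 a b = 2 * ln ((a + b) / 2) - ln a - ln b"
      by (simp add: jensen_gap_def pow_convex_def)
    moreover have "jensen_gap (-1) a b = 1 / (2 * a) + 1 / (2 * b) - 2 / (a + b)"
    proof -
      have "4 / (a * 2 + b * 2) = 2 / (a + b)"
        using assms by (simp add: field_simps)
      then show ?thesis
        using assms by (simp add: jensen_gap_def pow_convex_def powr_minus_divide mult.commute)
    qed
    ultimately show ?thesis using 1 assms
      by (simp add: lambda_mean_def)
  next
    case 2
    have "jensen_gap 0 a b = 2 * ln ((a + b) / 2) - ln a - ln b"
      by (simp add: jensen_gap_def pow_convex_def)
    moreover have "jensen_gap 1 a b = a * ln a + b * ln b - (a + b) * ln ((a + b) / 2)"
      by (simp add: jensen_gap_def pow_convex_def)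
    ultimately show ?thesis using 2 assms
      by (simp add: lambda_mean_def)
  next
    case 3
    define D where "D = a * ln a + b * ln b - (a + b) * ln ((a + b) / 2)"
    have "jensen_gap 1 a b = D"
      by (simp add: jensen_gap_def pow_convex_def D_def)
    moreover have "lambda_mean 1 a b = (b - a)\<^sup>2 / (4 * D)"
      using assms by (simp only: lambda_mean_def D_def) simp
    moreover have J2: "jensen_gap 2 a b = (b - a)\<^sup>2 / 4"
      using jensen_gap_two[OF assms(1,2)] by (simp add: power_divide)
    ultimately show ?thesis
      using 3 by (simp add: J2)
  next
    case 4
    define P where "P = (\<lambda>s. a powr s + b powr s - 2 * ((a + b) / 2) powr s)"
    have J: "jensen_gap r a b = P r / (r * (r - 1))" if "r \<noteq> 0" "r \<noteq> 1" for r
      using that by (simp only: jensen_gap_def pow_convex_def P_def if_False) (simp add: diff_divide_distrib add_divide_distrib)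
    have "s + 1 \<noteq> 0" "s - 1 \<noteq> 0" using 4 by auto
    moreover have "P s \<noteq> 0" using J[of s] 4 jensen_gap_pos[OF assms, of s] by auto
    ultimately have "(s - 1) / (s + 1) * (P (s + 1) / P s) = jensen_gap (s + 1) a b / jensen_gap s a b"
      using 4 by (simp add: J)
    then show ?thesis
      using 4 assms by (simp add: lambda_mean_def P_def)
  qed
qed

lemma lambda_mean_mono:
  assumes "0 < a" "0 < b" "s \<le> r"
  shows "lambda_mean s a b \<le> lambda_mean r a b"
proof (cases "a = b")
  case False
  \<comment> \<open>With \<open>k = c powr (r - s)\<close>, the second derivative of
    \<open>(\<phi>\<^sub>r\<^sub>+\<^sub>1 - c \<phi>\<^sub>r) - k (\<phi>\<^sub>s\<^sub>+\<^sub>1 - c \<phi>\<^sub>s)\<close> is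
    \<open>t powr (s - 2) * (t - c) * (t powr (r - s) - c powr (r - s)) \<ge> 0\<close>, and the choice of \<open>c\<close>
    annihilates the Jensen gap of the second bracket.\<close>
  define c where "c = lambda_mean s a b"
  note pos = jensen_gap_pos[OF assms(1,2) False]
  have c: "c = jensen_gap (s + 1) a b / jensen_gap s a b"
    unfolding c_def by (rule lambda_mean_eq_jensen_gap[OF assms(1,2) False])
  then have "0 < c" using pos by simp
  define k where "k = c powr (r - s)"
  define w where "w = (\<lambda>i::nat. [1, - c, - k, k * c] ! i)"
  define e where "e = (\<lambda>i::nat. [r + 1, r, s + 1, s] ! i)"
  have sum4: "(\<Sum>i\<in>{..<4}. f i) = f 0 + f 1 + f 2 + f 3" for f :: "nat \<Rightarrow> real"
    by (simp add: eval_nat_numeral)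
  have "0 \<le> (\<Sum>i\<in>{..<4}. w i * jensen_gap (e i) a b)"
  proof (rule jensen_gap_lincomb_nonneg)
    fix t assume "min a b \<le> t"
    then have "0 < t" using assms by auto
    have "0 \<le> (t - c) * (t powr (r - s) - c powr (r - s))"
      using \<open>0 < t\<close> \<open>0 < c\<close> assms(3) powr_mono2[of "r - s" c t] powr_mono2[of "r - s" t c]
      by (cases "c \<le> t") (simp_all add: mult_nonpos_nonpos)
    then have "0 \<le> t powr (s - 2) * ((t - c) * (t powr (r - s) - c powr (r - s)))"
      by simp
    also have "\<dots> = t powr (r + 1 - 2) - c * t powr (r - 2) - k * t powr (s + 1 - 2) + k * c * t powr (s - 2)"
    proof -
      have "t powr (r - 2) = t powr (s - 2) * t powr (r - s)"
        "t powr (r + 1 - 2) = t * (t powr (s - 2) * t powr (r - s))"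
        "t powr (s + 1 - 2) = t * t powr (s - 2)"
        using \<open>0 < t\<close> powr_mult_base[of t "r - 2"] powr_mult_base[of t "s - 2"]
        by (simp_all flip: powr_add add: add_diff_eq)
      then show ?thesis
        unfolding k_def by (simp add: algebra_simps)
    qed
    finally show "0 \<le> (\<Sum>i\<in>{..<4}. w i * t powr (e i - 2))"
      by (simp add: sum4 w_def e_def eval_nat_numeral)
  qed (use assms in auto)
  then have "0 \<le> jensen_gap (r + 1) a b - c * jensen_gap r a b - k * (jensen_gap (s + 1) a b - c * jensen_gap s a b)"
    by (simp add: sum4 w_def e_def eval_nat_numeral algebra_simps)
  moreover have "jensen_gap (s + 1) a b = c * jensen_gap s a b"
    using c pos[of s] by simp
  ultimately have "c * jensen_gap r a b \<le> jensen_gap (r + 1) a b" by simp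
  then have "c \<le> jensen_gap (r + 1) a b / jensen_gap r a b"
    using pos[of r] by (simp add: field_simps)
  then show ?thesis
    unfolding c_def lambda_mean_eq_jensen_gap[OF assms(1,2) False, of r] .
qed (simp add: lambda_mean_def)

section \<open>The upper bound by the arithmetic mean\<close>

lemma lambda_mean_two:
  assumes "0 < a" "0 < b"
  shows "lambda_mean 2 a b = arith_mean a b"
proof (cases "a = b")
  case False
  have "jensen_gap 3 a b = (a + b) / 2 * jensen_gap 2 a b"
  proof -
    have "jensen_gap 3 a b = a ^ 3 / 6 + b ^ 3 / 6 - 2 * (((a + b) / 2) ^ 3 / 6)"
      using assms by (simp add: jensen_gap_def pow_convex_def)
    then show ?thesis
      unfolding jensen_gap_two[OF assms]
      by (simp add: power2_eq_square power3_eq_cube field_split_simps)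
  qed
  then show ?thesis
    using jensen_gap_pos[OF assms False, of 2] lambda_mean_eq_jensen_gap[OF assms False, of 2]
    by (simp add: arith_mean_def)
qed (simp add: lambda_mean_def arith_mean_def)

lemma lambda_mean_le_arith_mean:
  assumes "0 < a" "0 < b" "s \<le> 2"
  shows "lambda_mean s a b \<le> arith_mean a b"
  using lambda_mean_mono[OF assms] lambda_mean_two[OF assms(1,2)] by simp

text \<open>Fix \<open>b = 2\<close> and let \<open>a\<close> tend to 0 from the right: the
  arithmetic mean tends to 1 and \<open>lambda_mean s a 2\<close> tends to
  \<open>L > 1\<close>.\<close>

lemma exists_lambda_mean_gt_arith_mean:
  assumes "2 < s"
  shows "\<exists>a b. 0 < a \<and> 0 < b \<and> arith_mean a b < lambda_mean s a b"
proof -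
  define u where "u = s - 2"
  \<comment> \<open>Four times this is \<open>2 powr s * (s - 3) + 4 > 0\<close>, which is
    \<open>L > 1\<close> after clearing denominators. For \<open>u < 1\<close> it follows from
    \<open>1 - u < 1 - u * ln 2 \<le> 2 powr (- u)\<close>.\<close>
  have "2 powr u * (u - 1) + 1 > 0"
  proof (cases "u \<ge> 1")
    case False
    have "0 < u" using assms by (simp add: u_def)
    have "1 - u < 1 - u * ln 2"
      using \<open>0 < u\<close> ln_2_less_1 by simp
    also have "\<dots> \<le> exp (- (u * ln 2))"
      using exp_ge_add_one_self[of "- (u * ln 2)"] by simp
    also have "\<dots> = 1 / 2 powr u"
      by (simp add: powr_def exp_minus field_simps)
    finally show ?thesis by (simp add: field_simps)
  qed (auto intro: add_nonneg_pos)
  then have "0 < 2 powr s * (s - 3) + 4"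
    by (simp add: u_def powr_diff)
  define F where "F = (\<lambda>a::real. (s - 1) / (s + 1) *
       ((a powr (s + 1) + 2 powr (s + 1) - 2 * ((a + 2) / 2) powr (s + 1)) /
        (a powr s + 2 powr s - 2 * ((a + 2) / 2) powr s)))"
  define L where "L = (s - 1) / (s + 1) * ((2 powr (s + 1) - 2) / (2 powr s - 2))"
  have "2 < (2::real) powr s"
    using assms powr_less_mono[of 1 s 2] by simp
  have "(F \<longlongrightarrow> (s - 1) / (s + 1) *
       ((0 powr (s + 1) + 2 powr (s + 1) - 2 * ((0 + 2) / 2) powr (s + 1)) /
        (0 powr s + 2 powr s - 2 * ((0 + 2) / 2) powr s))) (at_right 0)"
    unfolding F_def using assms \<open>2 < 2 powr s\<close>
    by (intro tendsto_intros tendsto_powr') (auto simp: eventually_at_right_less eventually_mono[OF eventually_at_right_less])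
  then have "(F \<longlongrightarrow> L) (at_right 0)"
    by (simp add: L_def)
  moreover have "1 < L"
  proof -
    have "(s + 1) * (2 powr s - 2) < (s - 1) * (2 powr (s + 1) - 2)"
      using \<open>0 < 2 powr s * (s - 3) + 4\<close> by (simp add: powr_add algebra_simps)
    moreover have "0 < (s + 1) * (2 powr s - 2)"
      using \<open>2 < 2 powr s\<close> assms by simp
    ultimately show ?thesis
      by (simp add: L_def)
  qed
  moreover have "((\<lambda>a. arith_mean a 2) \<longlongrightarrow> 1) (at_right 0)"
    unfolding arith_mean_def by (auto intro!: tendsto_eq_intros)
  \<comment> \<open>The difference \<open>F a - arith_mean a 2\<close> has the positive limit
    \<open>L - 1\<close>.\<close>
  ultimately have "\<forall>\<^sub>F a in at_right 0. arith_mean a 2 < F a"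
    by (intro order_tendstoD(1)[OF tendsto_diff, of F L _ _ _ 0, simplified])
  moreover have "\<forall>\<^sub>F a in at_right 0. 0 < (a::real) \<and> a < 2"
    by (auto simp: eventually_at_right_field intro!: exI[of _ 2])
  ultimately have "\<forall>\<^sub>F a in at_right 0. 0 < a \<and> a < 2 \<and> arith_mean a 2 < F a"
    by eventually_elim auto
  then obtain a where "0 < a" "a < 2" "arith_mean a 2 < F a"
    using eventually_happens'[OF trivial_limit_at_right_real] by blast
  then show ?thesis
    using assms by (intro exI[of _ a] exI[of _ 2]) (simp add: lambda_mean_def F_def)
qed

section \<open>Power series on the unit interval\<close>

lemma power_series_partial_sum_le:
  fixes a :: "nat \<Rightarrow> real"
  assumes sums: "\<And>z. 0 < z \<Longrightarrow> z < 1 \<Longrightarrow> (\<lambda>n. a n * z ^ n) sums f z"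
    and nonneg: "\<And>n. N \<le> n \<Longrightarrow> 0 \<le> a n"
    and lim: "(f \<longlongrightarrow> B) (at_left 1)"
  shows "(\<Sum>n<N. a n) \<le> B"
proof (rule tendsto_le[OF trivial_limit_at_left_real lim])
  show "((\<lambda>w. \<Sum>n<N. a n * w ^ n) \<longlongrightarrow> (\<Sum>n<N. a n)) (at_left 1)"
    by (auto intro!: tendsto_eq_intros)
  have "\<forall>\<^sub>F w in at_left 1. 0 < w \<and> w < (1::real)"
    by (auto simp: eventually_at_left_field intro!: exI[of _ 0])
  then show "\<forall>\<^sub>F w in at_left 1. (\<Sum>n<N. a n * w ^ n) \<le> f w"
  proof eventually_elim
    case (elim w)
    then have "(\<Sum>n<N. a n * w ^ n) \<le> (\<Sum>n. a n * w ^ n)"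
      using sums[of w] nonneg by (intro sum_le_suminf) (auto simp: sums_iff)
    then show ?case using sums[of w] elim by (simp add: sums_iff)
  qed
qed

text \<open>Replacing \<open>z ^ n\<close> by \<open>z ^ M\<close> for \<open>n \<ge> M\<close>
  lumps the tail into one monomial, whose coefficient is controlled by the limit \<open>B\<close>
  through the preceding lemma.\<close>

lemma power_series_tail_le:
  fixes a :: "nat \<Rightarrow> real"
  assumes sums: "\<And>z. 0 < z \<Longrightarrow> z < 1 \<Longrightarrow> (\<lambda>n. a n * z ^ n) sums f z"
    and nonneg: "\<And>n. M \<le> n \<Longrightarrow> 0 \<le> a n"
    and lim: "(f \<longlongrightarrow> B) (at_left 1)"
    and z: "0 < z" "z < 1"
  shows "f z \<le> (\<Sum>n<M. a n * z ^ n) + (B - (\<Sum>n<M. a n)) * z ^ M"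
proof -
  have "(\<lambda>N. \<Sum>n<N. a n * z ^ n) \<longlonglongrightarrow> f z"
    using sums[OF z] by (simp add: sums_def)
  then show ?thesis
  proof (rule LIMSEQ_le_const2)
    have "(\<Sum>n<N. a n * z ^ n) \<le> (\<Sum>n<M. a n * z ^ n) + (B - (\<Sum>n<M. a n)) * z ^ M"
      if "M \<le> N" for N
    proof -
      have "{..<N} = {..<M} \<union> {M..<N}" using that by auto
      then have split: "(\<Sum>n<N. g n) = (\<Sum>n<M. g n) + (\<Sum>n=M..<N. g n)" for g :: "nat \<Rightarrow> real"
        by (simp add: sum.union_disjoint ivl_disj_int)
      have "(\<Sum>n=M..<N. a n * z ^ n) \<le> (\<Sum>n=M..<N. a n * z ^ M)"
        using z nonneg by (intro sum_mono mult_left_mono power_decreasing) auto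
      also have "\<dots> = ((\<Sum>n<N. a n) - (\<Sum>n<M. a n)) * z ^ M"
        by (simp add: split sum_distrib_right)
      also have "\<dots> \<le> (B - (\<Sum>n<M. a n)) * z ^ M"
        using power_series_partial_sum_le[OF sums _ lim, of N] nonneg that z by (intro mult_right_mono) auto
      finally show ?thesis by (simp add: split)
    qed
    then show "\<exists>N. \<forall>n\<ge>N. (\<Sum>n<n. a n * z ^ n) \<le> (\<Sum>n<M. a n * z ^ n) + (B - (\<Sum>n<M. a n)) * z ^ M"
      by blast
  qed
qed

text \<open>Abel summation: since \<open>z ^ n\<close> decreases in \<open>n\<close>, each partial
  sum of the polynomial is at least \<open>z ^ n\<close> times the partial sum of the
  coefficients.\<close>

lemma sum_power_nonneg_if_partial_sums_nonneg:
  fixes c :: "nat \<Rightarrow> real"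
  assumes "\<And>n. n \<le> N \<Longrightarrow> 0 \<le> (\<Sum>i\<le>n. c i)" "0 \<le> z" "z \<le> 1"
  shows "0 \<le> (\<Sum>i\<le>N. c i * z ^ i)"
proof -
  have "(\<Sum>i\<le>n. c i) * z ^ n \<le> (\<Sum>i\<le>n. c i * z ^ i)" if "n \<le> N" for n
    using that
  proof (induction n)
    case (Suc n)
    have "(\<Sum>i\<le>n. c i) * z ^ Suc n \<le> (\<Sum>i\<le>n. c i) * z ^ n"
      using assms Suc.prems by (intro mult_left_mono power_decreasing) auto
    with Suc show ?case by (simp add: distrib_right)
  qed simp
  moreover have "0 \<le> (\<Sum>i\<le>N. c i) * z ^ N"
    using assms by simp
  ultimately show ?thesis by force
qed

text \<open>The coefficients of \<open>exp P\<close> satisfy the recursion with equality, by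
  comparing coefficients in \<open>z E' = z P' E\<close>. With \<le> it still gives
  \<open>E' \<le> P' E\<close>, so \<open>E * exp (- P)\<close> decreases from a value at most
  1.\<close>

lemma sum_power_le_exp_sum_power:
  fixes e p :: "nat \<Rightarrow> real"
  assumes nonneg: "\<And>n. 0 \<le> e n" "\<And>n. 0 \<le> p n"
    and "e 0 \<le> 1"
    and rec: "\<And>n. n \<le> N \<Longrightarrow> real n * e n \<le> (\<Sum>k\<le>n. real k * p k * e (n - k))"
    and "0 \<le> z"
  shows "(\<Sum>n\<le>N. e n * z ^ n) \<le> exp (\<Sum>k\<le>N. p k * z ^ k)"
proof -
  define E P where "E = (\<lambda>z. \<Sum>n\<le>N. e n * z ^ n)" and "P = (\<lambda>z. \<Sum>k\<le>N. p k * z ^ k)"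
  define E' P' where "E' = (\<lambda>z. \<Sum>n\<le>N. e n * (real n * z ^ (n - 1)))"
    and "P' = (\<lambda>z. \<Sum>k\<le>N. p k * (real k * z ^ (k - 1)))"
  define F where "F = (\<lambda>z. E z * exp (- P z))"
  have dE: "(E has_real_derivative E' t) (at t)" for t
    unfolding E_def E'_def by (auto intro!: derivative_eq_intros sum.cong)
  have dP: "(P has_real_derivative P' t) (at t)" for t
    unfolding P_def P'_def by (auto intro!: derivative_eq_intros sum.cong)
  have dF: "(F has_real_derivative (E' t - P' t * E t) * exp (- P t)) (at t)" for t
    unfolding F_def by (auto intro!: derivative_eq_intros dE dP simp: algebra_simps)
  have le: "E' t \<le> P' t * E t" if "0 < t" for t
  proof -
    have mult: "t * (\<Sum>n\<le>N. g n * (real n * t ^ (n - 1))) = (\<Sum>n\<le>N. (real n * g n) * t ^ n)" for g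
      unfolding sum_distrib_left
    proof (rule sum.cong[OF refl])
      show "t * (g n * (real n * t ^ (n - 1))) = real n * g n * t ^ n" for n
        by (cases n) auto
    qed
    have "t * E' t = (\<Sum>n\<le>N. (real n * e n) * t ^ n)"
      unfolding E'_def by (rule mult)
    also have "\<dots> \<le> (\<Sum>n\<le>N. (\<Sum>k\<le>n. real k * p k * e (n - k)) * t ^ n)"
      using rec that by (intro sum_mono mult_right_mono) auto
    also have "\<dots> = (\<Sum>n\<le>N. \<Sum>k\<le>n. (real k * p k * t ^ k) * (e (n - k) * t ^ (n - k)))"
      unfolding sum_distrib_right
    proof (intro sum.cong refl)
      fix n k :: nat assume "k \<in> {..n}"
      then have "t ^ n = t ^ k * t ^ (n - k)" by (simp flip: power_add)
      then show "real k * p k * e (n - k) * t ^ n = (real k * p k * t ^ k) * (e (n - k) * t ^ (n - k))"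
        by simp
    qed
    also have "\<dots> = (\<Sum>(i,j)\<in>{(i,j). i + j \<le> N}. (real i * p i * t ^ i) * (e j * t ^ j))"
      by (simp add: sum.triangle_reindex_eq)
    \<comment> \<open>Enlarging the triangle to the square adds only nonnegative terms and turns the
      truncated convolution into a product.\<close>
    also have "\<dots> \<le> (\<Sum>(i,j)\<in>{..N} \<times> {..N}. (real i * p i * t ^ i) * (e j * t ^ j))"
      using nonneg that by (intro sum_mono2) auto
    also have "\<dots> = (\<Sum>i\<le>N. real i * p i * t ^ i) * E t"
      by (simp add: E_def sum_product sum.cartesian_product)
    also have "(\<Sum>i\<le>N. real i * p i * t ^ i) = t * P' t"
      unfolding P'_def by (rule mult[symmetric])
    finally show ?thesis using that by (simp add: mult.assoc)
  qed
  have "F z \<le> F 0"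
  proof (rule DERIV_nonpos_imp_decreasing_open[OF \<open>0 \<le> z\<close>])
    show "\<exists>y. (F has_real_derivative y) (at t) \<and> y \<le> 0" if "0 < t" "t < z" for t
      using dF[of t] le[OF that(1)] by (intro exI conjI) (auto simp: mult_nonpos_nonneg)
    show "continuous_on {0..z} F"
      using dF by (auto intro!: DERIV_atLeastAtMost_imp_continuous_on)
  qed
  also have "(\<Sum>n\<le>N. g n * 0 ^ n) = g 0" for g :: "nat \<Rightarrow> real"
    by (induction N) auto
  then have "E 0 = e 0" "P 0 = p 0"
    by (simp_all add: E_def P_def)
  then have "F 0 \<le> 1"
    using assms(3) nonneg(1)[of 0] nonneg(2)[of 0] by (simp add: F_def mult_le_one)
  finally have "F z \<le> 1" .
  then have "E z \<le> exp (P z)"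
    by (simp add: F_def exp_minus divide_inverse[symmetric] pos_divide_le_eq)
  then show ?thesis
    by (simp only: E_def P_def)
qed

section \<open>Series in \<open>x\<^sup>2\<close> for the identric mean and the Jensen gaps\<close>

lemma ln_identric_sums:
  fixes x :: real
  assumes "0 < x" "x < 1"
  shows "(\<lambda>k. (x\<^sup>2) ^ k * (1 / (2 * real k + 1) - 1 / (2 * real k))) sums
    (((1 + x) * ln (1 + x) - (1 - x) * ln (1 - x)) / (2 * x))"
proof -
  have A: "(\<lambda>n. - ((- x) ^ n) / of_nat n) sums ln (1 + x)"
    using ln_series'[of x] assms by simp
  have B: "(\<lambda>n. - (x ^ n) / of_nat n) sums ln (1 - x)"
    using ln_series'[of "- x"] assms by simp
  have odd: "(\<lambda>k. 2 * x ^ (2 * k + 1) / (2 * real k + 1)) sums (ln (1 + x) - ln (1 - x))"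
  proof -
    have "(\<lambda>n. - ((- x) ^ n) / of_nat n - - (x ^ n) / of_nat n) sums (ln (1 + x) - ln (1 - x))"
      by (rule sums_diff[OF A B])
    then have "(\<lambda>k. - ((- x) ^ (2 * k + 1)) / of_nat (2 * k + 1) - - (x ^ (2 * k + 1)) / of_nat (2 * k + 1))
        sums (ln (1 + x) - ln (1 - x))"
    proof (subst sums_mono_reindex[where g = "\<lambda>k. 2 * k + 1"])
      fix n :: nat assume "n \<notin> range (\<lambda>k. 2 * k + 1)"
      then have "even n" by (metis oddE rangeI)
      then show "- ((- x) ^ n) / of_nat n - - (x ^ n) / of_nat n = 0" by simp
    qed (auto simp: strict_mono_def)
    then show ?thesis by (simp add: add.commute)
  qed
  \<comment> \<open>The term for \<open>k = 0\<close> is 0 because division by zero yields 0; for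
    the same reason the final series starts with the constant term 1.\<close>
  have even: "(\<lambda>k. - 2 * x ^ (2 * k) / (2 * real k)) sums (ln (1 + x) + ln (1 - x))"
  proof -
    have "(\<lambda>n. - ((- x) ^ n) / of_nat n + - (x ^ n) / of_nat n) sums (ln (1 + x) + ln (1 - x))"
      by (rule sums_add[OF A B])
    then have "(\<lambda>k. - ((- x) ^ (2 * k)) / of_nat (2 * k) + - (x ^ (2 * k)) / of_nat (2 * k))
        sums (ln (1 + x) + ln (1 - x))"
    proof (subst sums_mono_reindex[where g = "\<lambda>k. 2 * k"])
      fix n :: nat assume "n \<notin> range (\<lambda>k. 2 * k)"
      then have "odd n" by (metis evenE rangeI)
      then show "- ((- x) ^ n) / of_nat n + - (x ^ n) / of_nat n = 0" by simp
    qed (auto simp: strict_mono_def)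
    then show ?thesis by simp
  qed
  have "(\<lambda>k. (2 * x ^ (2 * k + 1) / (2 * real k + 1) + x * (- 2 * x ^ (2 * k) / (2 * real k))) / (2 * x)) sums
      (((ln (1 + x) - ln (1 - x)) + x * (ln (1 + x) + ln (1 - x))) / (2 * x))"
    by (intro sums_divide sums_add sums_mult odd even)
  moreover have "(2 * x ^ (2 * k + 1) / (2 * real k + 1) + x * (- 2 * x ^ (2 * k) / (2 * real k))) / (2 * x)
      = (x\<^sup>2) ^ k * (1 / (2 * real k + 1) - 1 / (2 * real k))" for k
  proof -
    have "(2 * (A * x) / u + x * (- 2 * A / v)) / (2 * x) = A * (1 / u - 1 / v)" for A u v
      using assms by (simp add: diff_divide_distrib right_diff_distrib)
    then show ?thesis by (simp only: power_add power_one_right power_mult)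
  qed
  moreover have "(ln (1 + x) - ln (1 - x)) + x * (ln (1 + x) + ln (1 - x)) = (1 + x) * ln (1 + x) - (1 - x) * ln (1 - x)"
    by algebra
  ultimately show ?thesis by simp
qed

text \<open>The left side is the logarithm of \<open>identric_mean (1 - x) (1 + x)\<close>. Its
  \<open>- 1\<close> cancels the constant term of the series, all later terms are negative, and the
  summand for \<open>k = 0\<close> on the right is 0.\<close>

lemma ln_identric_le:
  fixes x :: real
  assumes "0 < x" "x < 1"
  shows "((1 + x) * ln (1 + x) - (1 - x) * ln (1 - x)) / (2 * x) - 1
    \<le> - (\<Sum>k\<le>N. 1 / (2 * real k * (2 * real k + 1)) * (x\<^sup>2) ^ k)"
proof -
  define L where "L = ((1 + x) * ln (1 + x) - (1 - x) * ln (1 - x)) / (2 * x)"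
  define t where "t = (\<lambda>k. (x\<^sup>2) ^ k * (1 / (2 * real k + 1) - 1 / (2 * real k)))"
  have t: "t k = (if k = 0 then 1 else 0) - 1 / (2 * real k * (2 * real k + 1)) * (x\<^sup>2) ^ k" for k
    by (cases "k = 0") (simp_all add: t_def field_simps)
  have "t sums L"
    unfolding t_def L_def by (rule ln_identric_sums[OF assms])
  then have "(\<lambda>k. - t k) sums (- L)" by (rule sums_minus)
  moreover have "(\<Sum>k<Suc N. - t k) \<le> (\<Sum>k. - t k)"
    using calculation by (intro sum_le_suminf) (auto simp: sums_iff t)
  ultimately have "(\<Sum>k<Suc N. - t k) \<le> - L"
    by (simp add: sums_iff)
  also have "(\<Sum>k<Suc N. - t k) = (\<Sum>k\<le>N. 1 / (2 * real k * (2 * real k + 1)) * (x\<^sup>2) ^ k) - 1"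
    unfolding lessThan_Suc_atMost t by (simp add: sum_subtractf)
  finally show ?thesis by (simp add: L_def)
qed

text \<open>Odd powers cancel between the binomial series at \<open>x\<close> and
  \<open>- x\<close>; moving the constant term 2 to the right shifts the index by one.\<close>

lemma even_binomial_sums:
  fixes x r :: real
  assumes "\<bar>x\<bar> < 1"
  shows "(\<lambda>n. 2 * (r gchoose (2 * n + 2)) * x ^ (2 * n + 2)) sums ((1 + x) powr r + (1 - x) powr r - 2)"
proof -
  have "(\<lambda>n. (r gchoose n) * x ^ n + (r gchoose n) * (- x) ^ n) sums ((1 + x) powr r + (1 - x) powr r)"
    using gen_binomial_real[of x r] gen_binomial_real[of "- x" r] assms by (auto intro: sums_add)
  then have "(\<lambda>n. (r gchoose (2 * n)) * x ^ (2 * n) + (r gchoose (2 * n)) * (- x) ^ (2 * n)) sums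
      ((1 + x) powr r + (1 - x) powr r)"
  proof (subst sums_mono_reindex[where g = "\<lambda>k. 2 * k"])
    fix n :: nat assume "n \<notin> range (\<lambda>k. 2 * k)"
    then have "odd n" by (metis evenE rangeI)
    then show "(r gchoose n) * x ^ n + (r gchoose n) * (- x) ^ n = 0" by simp
  qed (auto simp: strict_mono_def)
  then have "(\<lambda>n. 2 * (r gchoose (2 * n)) * x ^ (2 * n)) sums ((1 + x) powr r + (1 - x) powr r)"
    by (simp add: mult.assoc)
  from sums_split_initial_segment[OF this, of 1] show ?thesis by simp
qed

definition even_coeff :: "real \<Rightarrow> nat \<Rightarrow> real" where
  "even_coeff r n = 2 * (r gchoose (2 * n + 2)) / (r * (r - 1))"

definition gap_ratio :: "real \<Rightarrow> real \<Rightarrow> real" where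
  "gap_ratio r z = ((1 + sqrt z) powr r + (1 - sqrt z) powr r - 2) / (r * (r - 1) * z)"

text \<open>\<open>gap_ratio r (x\<^sup>2) = jensen_gap r (1 - x) (1 + x) / x\<^sup>2\<close>, with Taylor coefficients
  \<^term>\<open>even_coeff r\<close>.\<close>

lemma even_coeff_0: "r \<noteq> 0 \<Longrightarrow> r \<noteq> 1 \<Longrightarrow> even_coeff r 0 = 1"
  by (simp add: even_coeff_def gbinomial_prod_rev numeral_2_eq_2)

lemma even_coeff_Suc:
  "even_coeff r (Suc n) = even_coeff r n *
    ((r - (2 * real n + 2)) * (r - (2 * real n + 3)) / ((2 * real n + 3) * (2 * real n + 4)))"
proof -
  have step: "r gchoose Suc k = (r gchoose k) * (r - real k) / (real k + 1)" for k
    using gbinomial_mult_1[of r k] by (simp add: field_simps)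
  have "r gchoose (2 * Suc n + 2) = (r gchoose (2 * n + 2)) *
    ((r - (2 * real n + 2)) * (r - (2 * real n + 3)) / ((2 * real n + 3) * (2 * real n + 4)))"
    using step[of "2 * n + 2"] step[of "Suc (2 * n + 2)"] by (simp add: algebra_simps)
  then show ?thesis
    by (simp add: even_coeff_def mult_ac)
qed

lemma gap_ratio_sums:
  assumes "r \<noteq> 0" "r \<noteq> 1" "0 < z" "z < 1"
  shows "(\<lambda>n. even_coeff r n * z ^ n) sums gap_ratio r z"
proof -
  have "(\<lambda>n. 2 * (r gchoose (2 * n + 2)) * sqrt z ^ (2 * n + 2) / (r * (r - 1) * z)) sums gap_ratio r z"
    unfolding gap_ratio_def using assms by (intro sums_divide even_binomial_sums) auto
  moreover have "2 * (r gchoose (2 * n + 2)) * sqrt z ^ (2 * n + 2) / (r * (r - 1) * z) = even_coeff r n * z ^ n" for n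
  proof -
    have "sqrt z ^ (2 * n + 2) = z ^ n * z"
      using assms by (simp add: power_add power_mult)
    then show ?thesis using assms by (simp add: even_coeff_def)
  qed
  ultimately show ?thesis by simp
qed

lemma tendsto_gap_ratio:
  assumes "0 < r" "r \<noteq> 1"
  shows "(gap_ratio r \<longlongrightarrow> (2 powr r - 2) / (r * (r - 1))) (at_left 1)"
proof -
  have "\<forall>\<^sub>F z in at_left 1. 0 < z \<and> z < (1::real)"
    by (auto simp: eventually_at_left_field intro!: exI[of _ 0])
  \<comment> \<open>The base \<open>1 - sqrt z\<close> tends to 0, where continuity of
    \<open>powr\<close> needs a base that is eventually nonnegative.\<close>
  then have ev: "\<forall>\<^sub>F z in at_left (1::real). 0 \<le> 1 - sqrt z"
    by eventually_elim simp
  have "(gap_ratio r \<longlongrightarrow> ((1 + sqrt 1) powr r + (1 - sqrt 1) powr r - 2) / (r * (r - 1) * 1)) (at_left 1)"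
    unfolding gap_ratio_def using assms
    by (intro tendsto_intros tendsto_powr') (use ev in auto)
  then show ?thesis by simp
qed

text \<open>The factor \<open>(r - 2) * (r - 3)\<close> makes the coefficient of \<open>z\<close>
  negative, and the later ratios are positive, so all coefficients after the constant 1 are
  nonpositive. The function therefore lies above its chord on the unit interval.\<close>

lemma gap_ratio_ge:
  assumes "2 < r" "r < 3" "0 < z" "z < 1"
  shows "1 - (1 - (2 powr r - 2) / (r * (r - 1))) * z \<le> gap_ratio r z"
proof -
  have neg: "even_coeff r (Suc n) \<le> 0" for n
  proof (induction n)
    case 0
    then show ?case
      using assms by (simp add: even_coeff_Suc even_coeff_0 mult_nonneg_nonpos divide_nonpos_pos)
  next
    case (Suc n)
    have "0 \<le> (r - (2 * real (Suc n) + 2)) * (r - (2 * real (Suc n) + 3))"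
      using assms by (intro mult_nonpos_nonpos) auto
    then show ?case
      using Suc unfolding even_coeff_Suc[of r "Suc n"] by (intro mult_nonpos_nonneg divide_nonneg_pos) auto
  qed
  have "- gap_ratio r z \<le> (\<Sum>n<1. - even_coeff r n * z ^ n) +
    (- ((2 powr r - 2) / (r * (r - 1))) - (\<Sum>n<1. - even_coeff r n)) * z ^ 1"
  proof (rule power_series_tail_le[where f = "\<lambda>z. - gap_ratio r z"])
    show "(\<lambda>n. - even_coeff r n * w ^ n) sums - gap_ratio r w" if "0 < w" "w < 1" for w
      using sums_minus[OF gap_ratio_sums[of r w]] assms that by simp
    show "0 \<le> - even_coeff r n" if "1 \<le> n" for n
      using neg[of "n - 1"] that by simp
    show "((\<lambda>z. - gap_ratio r z) \<longlongrightarrow> - ((2 powr r - 2) / (r * (r - 1)))) (at_left 1)"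
      using assms by (intro tendsto_minus tendsto_gap_ratio) auto
  qed (use assms in auto)
  then show ?thesis
    using assms by (simp add: even_coeff_0 algebra_simps)
qed

text \<open>For \<open>r = 1 + \<epsilon>\<close> each factor \<open>r - (j + 1)\<close> equals
  \<open>- j * (1 - \<epsilon> / j)\<close>. The signs cancel in pairs and the rational factors
  telescope.\<close>

lemma even_coeff_eq_prod:
  assumes "0 < \<epsilon>"
  shows "even_coeff (1 + \<epsilon>) n = (\<Prod>j=1..2*n. 1 - \<epsilon> / real j) / ((real n + 1) * (2 * real n + 1))"
proof (induction n)
  case 0
  then show ?case using assms by (simp add: even_coeff_0)
next
  case (Suc n)
  have "(\<Prod>j=1..2*Suc n. 1 - \<epsilon> / real j) =
      (\<Prod>j=1..2*n. 1 - \<epsilon> / real j) * (1 - \<epsilon> / (2 * real n + 1)) * (1 - \<epsilon> / (2 * real n + 2))"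
    by (simp add: algebra_simps)
  then show ?case
    unfolding even_coeff_Suc Suc by (simp add: divide_simps) (simp add: algebra_simps)
qed

text \<open>The first factor is exactly \<open>1 - \<epsilon>\<close>. Each later one satisfies
  \<open>1 - \<epsilon> / m \<ge> ((m - 1) / m) powr \<epsilon>\<close> by weighted AM-GM, and these
  bounds telescope.\<close>

lemma prod_one_minus_ge_powr:
  fixes \<epsilon> :: real
  assumes "0 \<le> \<epsilon>" "\<epsilon> \<le> 1"
  shows "(1 - \<epsilon>) * real (Suc J) powr (- \<epsilon>) \<le> (\<Prod>j=1..Suc J. 1 - \<epsilon> / real j)"
proof (induction J)
  case (Suc J)
  define u where "u = real (Suc J) / real (Suc (Suc J))"
  have "0 < u" by (simp add: u_def)
  have "u powr \<epsilon> * 1 powr (1 - \<epsilon>) \<le> \<epsilon> * u + (1 - \<epsilon>) * 1"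
    using assms \<open>0 < u\<close> by (intro Youngs_inequality_0) auto
  also have "\<epsilon> * u + (1 - \<epsilon>) * 1 = 1 - \<epsilon> / real (Suc (Suc J))"
    by (simp add: u_def field_simps)
  finally have "u powr \<epsilon> \<le> 1 - \<epsilon> / real (Suc (Suc J))"
    by simp
  then have "((1 - \<epsilon>) * real (Suc J) powr (- \<epsilon>)) * u powr \<epsilon> \<le>
      (\<Prod>j=1..Suc J. 1 - \<epsilon> / real j) * (1 - \<epsilon> / real (Suc (Suc J)))"
    using assms by (intro mult_mono Suc.IH prod_nonneg) (auto simp: field_simps)
  moreover have "real (Suc J) powr (- \<epsilon>) * u powr \<epsilon> = real (Suc (Suc J)) powr (- \<epsilon>)"
    by (simp add: u_def powr_divide powr_minus_divide del: of_nat_Suc)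
  ultimately show ?case
    by (simp only: mult.assoc prod.nat_ivl_Suc'[OF le_SucI] mult.commute[of "1 - \<epsilon> / real (Suc (Suc J))"])
qed simp

section \<open>The inequality at exponent 209/201\<close>

text \<open>Lower bounds for the coefficients of \<open>exp (\<Sum>k\<ge>1. z ^ k / (2 k (2 k + 1)))\<close>, which is
  \<open>1 / identric_mean (1 - x) (1 + x)\<close> for \<open>z = x\<^sup>2\<close>. The table is obtained from the recursion in
  \<open>exp_coeff_rec\<close> by rounding down to six decimals. Beyond it, \<open>1.342178\<close> is the sum of the table and
  the denominator \<open>4 n\<^sup>2 - 1\<close> is chosen to make the tail telescope.\<close>

definition exp_coeff_table :: "nat list" where
  "exp_coeff_table = [1000000, 166666, 63888, 32914, 19833, 13174, 9352, 6966, 5382, 4278, 3480,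
     2884, 2428, 2072, 1788, 1558, 1370, 1214, 1083, 971, 877]"

definition exp_coeff :: "nat \<Rightarrow> real" where
  "exp_coeff n =
    (if n \<le> 20 then real (exp_coeff_table ! n) / 10 ^ 6
     else if n \<le> 512 then 1.342178 / (4 * (real n)\<^sup>2 - 1) else 0)"

lemma exp_coeff_nonneg: "0 \<le> exp_coeff n"
proof (cases "n = 0")
  case False
  then have "1 \<le> (real n)\<^sup>2" by simp
  then show ?thesis by (simp add: exp_coeff_def)
qed (simp add: exp_coeff_def)

lemma sum_exp_coeff_table: "(\<Sum>j\<le>20. exp_coeff j) = 1.342178"
  by (simp add: exp_coeff_def exp_coeff_table_def atMost_nat_numeral)

text \<open>The weights \<open>2 * j - 1\<close> come from the tangent at \<open>j = 1/2\<close>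
  used in \<open>exp_coeff_rec\<close>.\<close>

lemma sum_exp_coeff_table_weighted: "(\<Sum>j\<le>20. exp_coeff j * (2 * real j - 1)) = 0.645536"
  by (simp add: exp_coeff_def exp_coeff_table_def atMost_nat_numeral)

lemma exp_coeff_table_rec:
  assumes "n \<le> 20"
  shows "real n * exp_coeff n \<le> (\<Sum>k\<le>n. real k * (1 / (2 * real k * (2 * real k + 1))) * exp_coeff (n - k))"
proof -
  have "\<forall>n\<in>{..20}. real n * exp_coeff n \<le> (\<Sum>k\<le>n. real k * (1 / (2 * real k * (2 * real k + 1))) * exp_coeff (n - k))"
    by (simp add: exp_coeff_def exp_coeff_table_def atMost_nat_numeral atMost_Suc)
  then show ?thesis using assms by blast
qed

lemma exp_coeff_rec:
  assumes "n \<le> 512"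
  shows "real n * exp_coeff n \<le> (\<Sum>k\<le>n. real k * (1 / (2 * real k * (2 * real k + 1))) * exp_coeff (n - k))"
proof (cases "n \<le> 20")
  case True
  then show ?thesis by (rule exp_coeff_table_rec)
next
  case False
  define x where "x = real n"
  have "21 \<le> x" using False by (simp add: x_def)
  \<comment> \<open>For \<open>S = 1.342178\<close> and \<open>T = 0.645536\<close> this is
    equivalent to \<open>x * S / (4 * x\<^sup>2 - 1) \<le> (S + T / (2 * x)) / (4 * x)\<close>,
    because \<open>4 * x\<^sup>2 / (4 * x\<^sup>2 - 1) = 1 + 1 / (4 * x\<^sup>2 -
    1)\<close>.\<close>
  have "2 * 1.342178 * x \<le> 0.645536 * (4 * x\<^sup>2 - 1)"
  proof -
    have "21 * x \<le> x * x" using \<open>21 \<le> x\<close> by (intro mult_right_mono) auto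
    then have "671089 * x \<le> 645536 * (x * x) - 161384"
      using \<open>21 \<le> x\<close> by linarith
    then show ?thesis by (simp add: power2_eq_square)
  qed
  moreover have "0 < 4 * x\<^sup>2 - 1"
    using \<open>21 \<le> x\<close> mult_mono[of 21 x 21 x] by (simp add: power2_eq_square)
  ultimately have "2 * 1.342178 * x / (4 * x\<^sup>2 - 1) \<le> 0.645536"
    by (simp only: pos_divide_le_eq)
  then have "(1.342178 + 2 * 1.342178 * x / (4 * x\<^sup>2 - 1) / (2 * x)) / (4 * x) \<le> (1.342178 + 0.645536 / (2 * x)) / (4 * x)"
    using \<open>21 \<le> x\<close> by (intro divide_right_mono add_left_mono) auto
  moreover have "(1.342178 + 2 * 1.342178 * x / (4 * x\<^sup>2 - 1) / (2 * x)) / (4 * x) = x * exp_coeff n"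
  proof -
    have "(S + 2 * S * x / (4 * x\<^sup>2 - 1) / (2 * x)) / (4 * x) = x * (S / (4 * x\<^sup>2 - 1))" for S
      using \<open>0 < 4 * x\<^sup>2 - 1\<close> \<open>21 \<le> x\<close> by (simp add: divide_simps) (simp add: algebra_simps power2_eq_square)
    moreover have "exp_coeff n = 1.342178 / (4 * x\<^sup>2 - 1)"
      using False assms by (simp add: exp_coeff_def x_def)
    ultimately show ?thesis by (simp only:)
  qed
  ultimately have "x * exp_coeff n \<le> (1.342178 + 0.645536 / (2 * x)) / (4 * x)"
    by simp
  \<comment> \<open>Only the terms with \<open>n - k \<le> 20\<close> of the convolution are kept, and the convex function
    \<open>1 / (2 * (2 * (n - j) + 1))\<close> is bounded below by its tangent at \<open>j = 1/2\<close>.\<close>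
  also have "\<dots> = (\<Sum>j\<le>20. exp_coeff j * ((1 + (2 * real j - 1) / (2 * x)) / (4 * x)))"
    unfolding sum_exp_coeff_table[symmetric] sum_exp_coeff_table_weighted[symmetric]
    by (simp add: sum_divide_distrib sum.distrib[symmetric] distrib_left add_divide_distrib)
  also have "\<dots> \<le> (\<Sum>j\<le>20. exp_coeff j * (1 / (2 * (2 * real (n - j) + 1))))"
  proof (intro sum_mono mult_left_mono exp_coeff_nonneg)
    fix j :: nat assume "j \<in> {..20}"
    then have j: "real (n - j) = x - real j" "real j \<le> 20" using False by (auto simp: x_def)
    define d where "d = 2 * real j - 1"
    have "0 < 2 * x - d" using j \<open>21 \<le> x\<close> by (simp add: d_def)
    have "(2 * x + d) * (2 * x - d) \<le> (2 * x) * (2 * x)"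
      by (simp add: algebra_simps)
    then have "(1 + d / (2 * x)) / (4 * x) \<le> 1 / (2 * (2 * x - d))"
      using \<open>0 < 2 * x - d\<close> \<open>21 \<le> x\<close> by (simp add: divide_simps) (simp add: algebra_simps)
    then show "(1 + (2 * real j - 1) / (2 * x)) / (4 * x) \<le> 1 / (2 * (2 * real (n - j) + 1))"
      by (simp add: d_def j algebra_simps)
  qed
  also have "\<dots> \<le> (\<Sum>j<n. exp_coeff j * (1 / (2 * (2 * real (n - j) + 1))))"
    using False by (intro sum_mono2 mult_nonneg_nonneg exp_coeff_nonneg) auto
  also have "\<dots> = (\<Sum>k=1..n. exp_coeff (n - k) * (1 / (2 * (2 * real k + 1))))"
    by (rule sum.reindex_bij_witness[of _ "\<lambda>k. n - k" "\<lambda>k. n - k"]) auto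
  also have "\<dots> = (\<Sum>k=1..n. real k * (1 / (2 * real k * (2 * real k + 1))) * exp_coeff (n - k))"
    by (rule sum.cong) auto
  also have "\<dots> \<le> (\<Sum>k\<le>n. real k * (1 / (2 * real k * (2 * real k + 1))) * exp_coeff (n - k))"
    by (intro sum_mono2) (auto intro!: mult_nonneg_nonneg exp_coeff_nonneg)
  finally show ?thesis by (simp add: x_def)
qed

lemma sum_exp_coeff: "(\<Sum>n\<le>512. exp_coeff n) = 1.342178 * (1 + (1 / 41 - 1 / 1025) / 2)"
proof -
  have tele: "(\<Sum>n=21..N. 1 / (4 * (real n)\<^sup>2 - 1)) = (1 / 41 - 1 / (2 * real N + 1)) / 2" if "20 \<le> N" for N
    using that
  proof (induction N rule: dec_induct)
    case (step N)
    have "1 / (4 * (real (Suc N))\<^sup>2 - 1) = (1 / (2 * real N + 1) - 1 / (2 * real (Suc N) + 1)) / 2"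
    proof -
      have "4 * (real (Suc N))\<^sup>2 - 1 = (2 * real N + 1) * (2 * real (Suc N) + 1)"
        by (simp add: algebra_simps power2_eq_square)
      then show ?thesis by (simp add: divide_simps)
    qed
    then show ?case using step by simp
  qed simp
  have "{..512} = {..20} \<union> {21..512::nat}" by auto
  then have "(\<Sum>n\<le>512. exp_coeff n) = (\<Sum>n\<le>20. exp_coeff n) + (\<Sum>n=21..512. exp_coeff n)"
    by (simp only:) (rule sum.union_disjoint, auto)
  also have "(\<Sum>n=21..512. exp_coeff n) = 1.342178 * (\<Sum>n=21..512. 1 / (4 * (real n)\<^sup>2 - 1))"
    unfolding sum_distrib_left by (rule sum.cong) (auto simp: exp_coeff_def)
  finally show ?thesis
    by (simp add: sum_exp_coeff_table tele)
qed

section \<open>Numerical bounds for \<open>2 powr (8 / 201)\<close>\<close>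

lemma power_double_bounds:
  fixes x a b :: real
  assumes "0 \<le> x" "0 \<le> a"
  shows "x ^ n \<le> a \<Longrightarrow> a * a \<le> b \<Longrightarrow> x ^ (2 * n) \<le> b"
    and "a \<le> x ^ n \<Longrightarrow> b \<le> a * a \<Longrightarrow> b \<le> x ^ (2 * n)"
proof -
  have eq: "x ^ (2 * n) = x ^ n * x ^ n" by (simp add: mult_2 power_add)
  show "x ^ n \<le> a \<Longrightarrow> a * a \<le> b \<Longrightarrow> x ^ (2 * n) \<le> b"
    unfolding eq using assms mult_mono[of "x ^ n" a "x ^ n" a] by simp
  show "a \<le> x ^ n \<Longrightarrow> b \<le> a * a \<Longrightarrow> b \<le> x ^ (2 * n)"
    unfolding eq using assms mult_mono[of a "x ^ n" a "x ^ n"] by simp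
qed

text \<open>The 201st power is 256, and \<open>201 = 128 + 64 + 8 + 1\<close> is reached by repeated
  squaring with outward rounding. Several digits are needed since \<open>2 * c - 2\<close> is later
  divided by the small number \<open>209 / 201 * (8 / 201)\<close>.\<close>

lemma two_powr_bounds: "1.0279719 \<le> (2::real) powr (8 / 201)" "(2::real) powr (8 / 201) \<le> 1.0279722"
proof -
  have c: "((2::real) powr (8 / 201)) ^ 201 = 256"
    by (simp add: powr_powr flip: powr_realpow)
  define u v :: real where "u = 1.0279719" and "v = 1.0279722"
  have "0 \<le> u" "0 \<le> v" by (simp_all add: u_def v_def)
  note u = power_double_bounds(1)[OF \<open>0 \<le> u\<close>] and v = power_double_bounds(2)[OF \<open>0 \<le> v\<close>]
  have u2: "u ^ 2 \<le> 1.05672623"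
    using u[of "1.0279719" 1 "1.05672623"] by (simp add: u_def)
  have u4: "u ^ 4 \<le> 1.11667033"
    using u[of "1.05672623" 2 "1.11667033"] u2 by simp
  have u8: "u ^ 8 \<le> 1.24695263"
    using u[of "1.11667033" 4 "1.24695263"] u4 by simp
  have u16: "u ^ 16 \<le> 1.55489087"
    using u[of "1.24695263" 8 "1.55489087"] u8 by simp
  have u32: "u ^ 32 \<le> 2.41768562"
    using u[of "1.55489087" 16 "2.41768562"] u16 by simp
  have u64: "u ^ 64 \<le> 5.84520376"
    using u[of "2.41768562" 32 "5.84520376"] u32 by simp
  have u128: "u ^ 128 \<le> 34.166407"
    using u[of "5.84520376" 64 "34.166407"] u64 by simp
  have v2: "1.05672684 \<le> v ^ 2"
    using v[of "1.0279722" 1 "1.05672684"] by (simp add: v_def)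
  have v4: "1.11667161 \<le> v ^ 4"
    using v[of "1.05672684" 2 "1.11667161"] v2 by simp
  have v8: "1.24695548 \<le> v ^ 8"
    using v[of "1.11667161" 4 "1.24695548"] v4 by simp
  have v16: "1.55489796 \<le> v ^ 16"
    using v[of "1.24695548" 8 "1.55489796"] v8 by simp
  have v32: "2.41770766 \<le> v ^ 32"
    using v[of "1.55489796" 16 "2.41770766"] v16 by simp
  have v64: "5.84531032 \<le> v ^ 64"
    using v[of "2.41770766" 32 "5.84531032"] v32 by simp
  have v128: "34.16765273 \<le> v ^ 128"
    using v[of "5.84531032" 64 "34.16765273"] v64 by simp
  have eq: "x ^ 201 = x ^ 128 * x ^ 64 * x ^ 8 * x" for x :: real
    by (simp flip: power_add power_Suc2)
  have "u ^ 201 \<le> 34.166407 * 5.84520376 * 1.24695263 * u"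
    unfolding eq using u128 u64 u8 \<open>0 \<le> u\<close> by (intro mult_mono) auto
  also have "\<dots> \<le> 256" by (simp add: u_def)
  finally have "u ^ 201 \<le> ((2::real) powr (8 / 201)) ^ 201" using c by simp
  then show "1.0279719 \<le> (2::real) powr (8 / 201)"
    unfolding u_def by (rule power_le_imp_le_base[where n = 200, simplified]) simp
  have "256 \<le> 34.16765273 * 5.84531032 * 1.24695548 * v" by (simp add: v_def)
  also have "\<dots> \<le> v ^ 201"
    unfolding eq using v128 v64 v8 \<open>0 \<le> v\<close> by (intro mult_mono) auto
  finally have "((2::real) powr (8 / 201)) ^ 201 \<le> v ^ 201" using c by simp
  then show "(2::real) powr (8 / 201) \<le> 1.0279722"
    unfolding v_def by (rule power_le_imp_le_base[where n = 200, simplified]) simp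
qed

text \<open>By \<open>even_coeff_eq_prod\<close> the claim compares
  \<open>exp_coeff n * (n + 1) * (2 * n + 1)\<close> with the decreasing product
  \<open>P (2 * n)\<close>. On each of the ranges ending at 6, 20 and 512 the product is replaced by
  its value at the right end.\<close>

lemma exp_coeff_le_even_coeff:
  assumes "5 \<le> n" "n \<le> 512"
  shows "exp_coeff n \<le> even_coeff (209 / 201) n"
proof -
  define P where "P = (\<lambda>m. \<Prod>j=1..m. 1 - (8 / 201) / real j)"
  have anti: "P k \<le> P m" if "m \<le> k" for m k
    using that
  proof (induction k rule: dec_induct)
    case (step k)
    have "0 \<le> P k" unfolding P_def by (intro prod_nonneg) (auto simp: field_simps)
    moreover have "P (Suc k) = P k * (1 - (8 / 201) / real (Suc k))"
      by (simp add: P_def)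
    ultimately have "P (Suc k) \<le> P k"
      by (simp add: mult_left_le)
    with step show ?case by simp
  qed simp
  have P12: "0.87 \<le> P 12" and P40: "0.8365 \<le> P 40"
    by (simp_all add: P_def prod.atLeast1_atMost_eq lessThan_nat_numeral lessThan_Suc)
  \<comment> \<open>Here the power bound replaces direct evaluation; \<open>1024 = 2 ^ 10\<close>
    turns it into the tenth power of \<open>2 powr (8 / 201)\<close>.\<close>
  have P1024: "0.7286 \<le> P 1024"
  proof -
    define c where "c = (2::real) powr (8 / 201)"
    have "c ^ 10 \<le> 1.0279722 ^ 10"
      using two_powr_bounds(2) by (intro power_mono) (auto simp: c_def)
    moreover have "real 1024 powr (- (8 / 201)) = 1 / c ^ 10"
    proof -
      have "real 1024 = 2 powr 10" by simp
      then have "real 1024 powr (8 / 201) = c ^ 10"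
        by (simp only: powr_powr c_def) (simp add: powr_powr flip: powr_realpow)
      then show ?thesis by (simp add: powr_minus_divide)
    qed
    ultimately have "1 / 1.0279722 ^ 10 \<le> real 1024 powr (- (8 / 201))"
      by (simp add: frac_le c_def)
    moreover have "(1 - 8 / 201) * real (Suc 1023) powr (- (8 / 201)) \<le> P (Suc 1023)"
      unfolding P_def by (rule prod_one_minus_ge_powr) auto
    moreover have "0.7286 \<le> (1 - 8 / 201) * (1 / 1.0279722 ^ 10 :: real)"
      by (simp add: power_divide)
    ultimately show ?thesis by simp
  qed
  have "exp_coeff n * ((real n + 1) * (2 * real n + 1)) \<le> P (2 * n)"
  proof (cases "n \<le> 20")
    case True
    show ?thesis
    proof (cases "n \<le> 6")
      case True
      then have "n = 5 \<or> n = 6" using assms by linarith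
      then have "exp_coeff n * ((real n + 1) * (2 * real n + 1)) \<le> 0.87"
        by (auto simp: exp_coeff_def exp_coeff_table_def)
      also have "\<dots> \<le> P (2 * n)" using anti[of "2 * n" 12] True P12 by simp
      finally show ?thesis .
    next
      case False
      then have "n \<in> {7, 8, 9, 10, 11, 12, 13, 14, 15, 16, 17, 18, 19, 20}" using True by simp arith
      then have "exp_coeff n * ((real n + 1) * (2 * real n + 1)) \<le> 0.8365"
        by (auto simp: exp_coeff_def exp_coeff_table_def)
      also have "\<dots> \<le> P (2 * n)" using anti[of "2 * n" 40] True P40 by simp
      finally show ?thesis .
    qed
  next
    case False
    define x where "x = real n"
    have "21 \<le> x" using False by (simp add: x_def)
    have "exp_coeff n * ((x + 1) * (2 * x + 1)) = 1.342178 * ((x + 1) * (2 * x + 1)) / ((2 * x - 1) * (2 * x + 1))"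
      using False assms by (simp add: exp_coeff_def x_def power2_eq_square algebra_simps)
    also have "\<dots> = 1.342178 * (x + 1) / (2 * x - 1)"
      using \<open>21 \<le> x\<close> by simp
    also have "\<dots> \<le> 0.7286"
      using \<open>21 \<le> x\<close> by (simp add: divide_simps)
    also have "\<dots> \<le> P (2 * n)"
      using anti[of "2 * n" 1024] assms P1024 by simp
    finally show ?thesis by (simp add: x_def)
  qed
  then show ?thesis
    using even_coeff_eq_prod[of "8 / 201" n] by (simp add: P_def pos_le_divide_eq)
qed

text \<open>These are the four small indices of the Abel summation in
  \<open>gap_ratio_exp_le\<close>; 0.0045 is an upper bound for the \<open>\<eta>\<close> occurring
  there.\<close>

lemma exp_coeff_partial_sums:
  assumes "1 \<le> n" "n \<le> 4" "\<eta> \<le> 0.0045"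
  shows "\<eta> * (\<Sum>i<n. exp_coeff i) + (\<Sum>i\<le>n. even_coeff (209 / 201) i) \<le> (\<Sum>i\<le>n. exp_coeff i)"
proof -
  have "0 \<le> (\<Sum>i<n. exp_coeff i)" by (intro sum_nonneg exp_coeff_nonneg)
  then have "\<eta> * (\<Sum>i<n. exp_coeff i) \<le> 0.0045 * (\<Sum>i<n. exp_coeff i)"
    using assms by (intro mult_right_mono)
  moreover have "0.0045 * (\<Sum>i<n. exp_coeff i) + (\<Sum>i\<le>n. even_coeff (209 / 201) i) \<le> (\<Sum>i\<le>n. exp_coeff i)"
  proof -
    have "n = Suc 0 \<or> n = Suc (Suc 0) \<or> n = Suc (Suc (Suc 0)) \<or> n = Suc (Suc (Suc (Suc 0)))"
      using assms by auto
    then show ?thesis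
      by (auto simp: even_coeff_Suc even_coeff_0 exp_coeff_def exp_coeff_table_def)
  qed
  ultimately show ?thesis by simp
qed

text \<open>The left side is bounded above by a polynomial with lumped tail,
  \<open>gap_ratio (410 / 201)\<close> below by its chord \<open>1 - \<eta> * z\<close>, and the
  exponential below by the polynomial with coefficients \<open>exp_coeff\<close>. A polynomial
  inequality on the unit interval remains.\<close>

lemma gap_ratio_exp_le:
  fixes z :: real
  assumes "0 < z" "z < 1"
  shows "gap_ratio (209 / 201) z \<le>
    exp (\<Sum>k\<le>512. 1 / (2 * real k * (2 * real k + 1)) * z ^ k) * gap_ratio (410 / 201) z"
proof -
  define c where "c = (2::real) powr (8 / 201)"
  have c: "1.0279719 \<le> c" "c \<le> 1.0279722"
    using two_powr_bounds by (simp_all add: c_def)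
  have c1: "2 powr (209 / 201) = 2 * c" and c2: "2 powr (410 / 201) = 4 * c"
    using powr_add[of 2 1 "8 / 201 :: real"] powr_add[of 2 2 "8 / 201 :: real"] by (simp_all add: c_def)
  define \<eta> B where "\<eta> = 1 - (4 * c - 2) / (410 / 201 * (209 / 201))" and "B = (2 * c - 2) / (209 / 201 * (8 / 201))"
  have \<eta>: "0 \<le> \<eta>" "\<eta> \<le> 0.0045"
    using c by (simp_all add: \<eta>_def)
  \<comment> \<open>The part of the series from degree 513 on is lumped into the single monomial \<open>z ^ 513\<close>; as all
    coefficients are nonnegative this is an upper bound on \<open>[0, 1]\<close>, exact at \<open>z = 1\<close>. By Abel
    summation it then suffices that the partial sums of the coefficients \<open>a\<close> are nonnegative. From
    index 5 on \<open>a\<close> is nonpositive, which reduces everything to four small indices and the total.\<close>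
  define D where "D = (\<lambda>n. if n < 513 then even_coeff (209 / 201) n else B - (\<Sum>i<513. even_coeff (209 / 201) i))"
  define a where "a = (\<lambda>n. exp_coeff n - (if n = 0 then 0 else \<eta> * exp_coeff (n - 1)) - D n)"
  have even_coeff_nonneg: "0 \<le> even_coeff (209 / 201) n" for n
  proof -
    have "0 \<le> (\<Prod>j=1..2*n. 1 - (8 / 201) / real j)"
      by (intro prod_nonneg) (auto simp: field_simps)
    then show ?thesis using even_coeff_eq_prod[of "8 / 201" n] by simp
  qed
  have lim: "(gap_ratio (209 / 201) \<longlongrightarrow> B) (at_left 1)"
    using tendsto_gap_ratio[of "209 / 201"] unfolding c1 by (simp add: B_def)
  have upper: "gap_ratio (209 / 201) z \<le> (\<Sum>n\<le>513. D n * z ^ n)"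
  proof -
    have "gap_ratio (209 / 201) z \<le> (\<Sum>n<513. even_coeff (209 / 201) n * z ^ n) + (B - (\<Sum>n<513. even_coeff (209 / 201) n)) * z ^ 513"
      by (rule power_series_tail_le[OF gap_ratio_sums _ lim]) (use assms even_coeff_nonneg in auto)
    also have "\<dots> = (\<Sum>n<513. D n * z ^ n) + D 513 * z ^ 513"
      by (intro arg_cong2[where f = "(+)"] sum.cong) (auto simp: D_def)
    also have "\<dots> = (\<Sum>n\<le>513. D n * z ^ n)"
    proof -
      have "{..513::nat} = insert 513 {..<513}" by auto
      then show ?thesis by simp
    qed
    finally show ?thesis .
  qed
  have "0 \<le> (\<Sum>n\<le>513. a n * z ^ n)"
  proof (rule sum_power_nonneg_if_partial_sums_nonneg)
    have part: "(\<Sum>i\<le>n. a i) = (\<Sum>i\<le>n. exp_coeff i) - \<eta> * (\<Sum>i<n. exp_coeff i) - (\<Sum>i\<le>n. D i)" for n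
      by (induction n) (auto simp: a_def algebra_simps lessThan_Suc_atMost[symmetric])
    \<comment> \<open>At \<open>z = 1\<close> the lumped coefficients add up to the limit
      \<open>B\<close>, so the total is the numerical comparison of \<open>B\<close> with
      \<open>(1 - \<eta>)\<close> times \<open>sum_exp_coeff\<close>.\<close>
    have total: "0 \<le> (\<Sum>i\<le>513. a i)"
    proof -
      have "{..513::nat} = insert 513 {..512}" "{..<513::nat} = {..512}" "{..513::nat} = insert 513 {..<513}" by auto
      then have "(\<Sum>i\<le>513. a i) = (1 - \<eta>) * (\<Sum>i\<le>512. exp_coeff i) - B"
        unfolding part by (simp add: D_def exp_coeff_def[of 513] algebra_simps)
      also have "\<dots> \<ge> 0"
        unfolding sum_exp_coeff \<eta>_def B_def using c by simp
      finally show ?thesis .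
    qed
    have neg: "a n \<le> 0" if "5 \<le> n" "n \<le> 513" for n
    proof -
      have "exp_coeff n \<le> D n"
      proof (cases "n = 513")
        case True
        have "(\<Sum>i<513. even_coeff (209 / 201) i) \<le> B"
          by (rule power_series_partial_sum_le[OF gap_ratio_sums _ lim]) (use even_coeff_nonneg in auto)
        then show ?thesis using True by (simp add: D_def exp_coeff_def)
      qed (use exp_coeff_le_even_coeff that in \<open>auto simp: D_def\<close>)
      moreover have "0 \<le> \<eta> * exp_coeff (n - 1)"
        using \<eta> by (simp add: exp_coeff_nonneg)
      ultimately show ?thesis
        using that by (simp add: a_def)
    qed
    fix n :: nat assume "n \<le> 513"
    consider "n = 0" | "1 \<le> n" "n \<le> 4" | "5 \<le> n" by linarith
    then show "0 \<le> (\<Sum>i\<le>n. a i)"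
    proof cases
      case 1
      then show ?thesis by (simp add: a_def D_def even_coeff_0 exp_coeff_def exp_coeff_table_def)
    next
      case 2
      then have "(\<Sum>i\<le>n. D i) = (\<Sum>i\<le>n. even_coeff (209 / 201) i)"
        by (intro sum.cong) (auto simp: D_def)
      then show ?thesis
        using exp_coeff_partial_sums[OF 2 \<eta>(2)] unfolding part by simp
    next
      case 3
      have "(\<Sum>i\<le>513. a i) = (\<Sum>i\<le>n. a i) + (\<Sum>i\<in>{n<..513}. a i)"
        using \<open>n \<le> 513\<close> by (subst sum.union_disjoint[symmetric]) (auto simp: ivl_disj_un)
      moreover have "(\<Sum>i\<in>{n<..513}. a i) \<le> 0"
        using 3 neg by (intro sum_nonpos) auto
      ultimately show ?thesis using total by simp
    qed
  qed (use assms in auto)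
  \<comment> \<open>The factor \<open>1 - \<eta> * z\<close> shifts \<open>exp_coeff\<close> by one
    index; as \<open>exp_coeff 513 = 0\<close>, the product has degree at most 513 and nothing is
    cut off.\<close>
  moreover have "(\<Sum>n\<le>513. a n * z ^ n) = (1 - \<eta> * z) * (\<Sum>n\<le>512. exp_coeff n * z ^ n) - (\<Sum>n\<le>513. D n * z ^ n)"
  proof -
    have "(\<Sum>n\<le>N. a n * z ^ n) = (\<Sum>n\<le>N. exp_coeff n * z ^ n) - \<eta> * z * (\<Sum>n<N. exp_coeff n * z ^ n) - (\<Sum>n\<le>N. D n * z ^ n)" for N
      by (induction N) (auto simp: a_def algebra_simps lessThan_Suc_atMost[symmetric])
    note this[of 513]
    moreover have "(\<Sum>n\<le>513. exp_coeff n * z ^ n) = (\<Sum>n\<le>512. exp_coeff n * z ^ n)"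
    proof -
      have "{..513::nat} = insert 513 {..512}" by auto
      then show ?thesis by (simp add: exp_coeff_def[of 513])
    qed
    moreover have "{..<513::nat} = {..512}" by auto
    ultimately show ?thesis by (simp add: left_diff_distrib)
  qed
  ultimately have "gap_ratio (209 / 201) z \<le> (1 - \<eta> * z) * (\<Sum>n\<le>512. exp_coeff n * z ^ n)"
    using upper by simp
  also have "\<dots> \<le> (1 - \<eta> * z) * exp (\<Sum>k\<le>512. 1 / (2 * real k * (2 * real k + 1)) * z ^ k)"
  proof (intro mult_left_mono sum_power_le_exp_sum_power exp_coeff_nonneg exp_coeff_rec)
    show "0 \<le> 1 - \<eta> * z"
      using mult_mono[of \<eta> 1 z 1] \<eta> assms by simp
  qed (use assms in \<open>auto simp: exp_coeff_def exp_coeff_table_def\<close>)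
  also have "\<dots> \<le> gap_ratio (410 / 201) z * exp (\<Sum>k\<le>512. 1 / (2 * real k * (2 * real k + 1)) * z ^ k)"
    using gap_ratio_ge[of "410 / 201" z] assms unfolding c2
    by (intro mult_right_mono) (auto simp: \<eta>_def)
  finally show ?thesis by (simp add: mult.commute)
qed

section \<open>Reduction to the pair \<open>1 - x\<close>, \<open>1 + x\<close>\<close>

lemma identric_mean_eq_exp:
  assumes "0 < a" "0 < b" "a \<noteq> b"
  shows "identric_mean a b = exp ((b * ln b - a * ln a) / (b - a) - 1)"
proof -
  have "b powr b / a powr a = exp (b * ln b - a * ln a)"
    using assms by (simp add: powr_def exp_diff)
  then have "identric_mean a b = 1 / exp 1 * exp (b * ln b - a * ln a) powr (1 / (b - a))"
    using assms by (simp add: identric_mean_def)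
  also have "exp (b * ln b - a * ln a) powr (1 / (b - a)) = exp ((b * ln b - a * ln a) / (b - a))"
    unfolding powr_def by simp
  finally show ?thesis
    by (simp add: exp_diff)
qed

lemma identric_mean_commute:
  assumes "0 < a" "0 < b"
  shows "identric_mean a b = identric_mean b a"
proof (cases "a = b")
  case False
  have "(b * ln b - a * ln a) / (b - a) = (a * ln a - b * ln b) / (a - b)"
    by (metis minus_diff_eq minus_divide_divide)
  then show ?thesis
    using False assms by (simp add: identric_mean_eq_exp)
qed simp

lemma jensen_gap_commute: "jensen_gap s a b = jensen_gap s b a"
  by (simp add: jensen_gap_def add.commute)

lemma lambda_mean_commute:
  assumes "0 < a" "0 < b"
  shows "lambda_mean s a b = lambda_mean s b a"
  using assms by (cases "a = b") (simp_all add: lambda_mean_eq_jensen_gap jensen_gap_commute[of _ a b])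

lemma jensen_gap_eq_gap_ratio:
  assumes "0 < A" "0 < x" "x < 1" "r \<noteq> 0" "r \<noteq> 1"
  shows "jensen_gap r (A * (1 - x)) (A * (1 + x)) = A powr r * x\<^sup>2 * gap_ratio r (x\<^sup>2)"
proof -
  have "(A * (1 - x) + A * (1 + x)) / 2 = A" by (simp add: algebra_simps)
  moreover have "(A * (1 - x)) powr r = A powr r * (1 - x) powr r" "(A * (1 + x)) powr r = A powr r * (1 + x) powr r"
    using assms by (simp_all add: powr_mult)
  ultimately have "jensen_gap r (A * (1 - x)) (A * (1 + x)) =
      A powr r * ((1 + x) powr r + (1 - x) powr r - 2) / (r * (r - 1))"
    using assms(4,5)
    by (simp add: jensen_gap_def pow_convex_def distrib_left right_diff_distrib add_divide_distrib diff_divide_distrib)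
  then show ?thesis
    using assms by (simp add: gap_ratio_def)
qed

text \<open>By symmetry \<open>a < b\<close>. With mean \<open>A\<close> and
  \<open>x = (b - a) / (a + b)\<close>, homogeneity gives
  \<open>lambda_mean (209 / 201) a b = A * (g2 / g1)\<close>, while the identric mean is at most
  \<open>A * exp (- p)\<close> for the truncated series \<open>p\<close>.\<close>

lemma identric_mean_le_lambda_mean_209_201:
  assumes "0 < a" "0 < b"
  shows "identric_mean a b \<le> lambda_mean (209 / 201) a b"
proof -
  have less: "identric_mean a b \<le> lambda_mean (209 / 201) a b" if "0 < a" "a < b" for a b
  proof -
    define A x where "A = (a + b) / 2" and "x = (b - a) / (a + b)"
    have "0 < A" "0 < x" "x < 1" using that by (auto simp: A_def x_def field_simps)
    have "A * x = (b - a) / 2"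
    proof -
      have "(a + b) / 2 * (d / (a + b)) = d / 2" for d
        using that by (simp add: divide_simps)
      then show ?thesis unfolding A_def x_def .
    qed
    then have ab: "a = A * (1 - x)" "b = A * (1 + x)"
      by (simp_all add: A_def right_diff_distrib distrib_left field_simps)
    define p where "p = (\<Sum>k\<le>512. 1 / (2 * real k * (2 * real k + 1)) * (x\<^sup>2) ^ k)"
    define g1 g2 where "g1 = gap_ratio (209 / 201) (x\<^sup>2)" and "g2 = gap_ratio (410 / 201) (x\<^sup>2)"
    have J1: "jensen_gap (209 / 201) a b = A powr (209 / 201) * x\<^sup>2 * g1"
      and J2: "jensen_gap (209 / 201 + 1) a b = A powr (209 / 201 + 1) * x\<^sup>2 * g2"
      unfolding ab g1_def g2_def using \<open>0 < A\<close> \<open>0 < x\<close> \<open>x < 1\<close>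
      by (simp_all add: jensen_gap_eq_gap_ratio)
    have "0 < jensen_gap (209 / 201) a b" using that by (intro jensen_gap_pos) auto
    moreover have "0 < A powr (209 / 201) * x\<^sup>2" using \<open>0 < A\<close> \<open>0 < x\<close> by simp
    ultimately have "0 < g1" unfolding J1 by (rule zero_less_mult_pos)
    have lambda: "lambda_mean (209 / 201) a b = A * (g2 / g1)"
      using that lambda_mean_eq_jensen_gap[of a b "209 / 201"] J1 J2 \<open>0 < A\<close> \<open>0 < x\<close>
      by (simp only: powr_add) simp
    define L where "L = ((1 + x) * ln (1 + x) - (1 - x) * ln (1 - x)) / (2 * x)"
    have "(b * ln b - a * ln a) / (b - a) = ln A + L"
    proof -
      have "b * ln b - a * ln a = (b - a) * ln A + A * ((1 + x) * ln (1 + x) - (1 - x) * ln (1 - x))"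
      proof -
        have eqs: "ln (A * (1 - x)) = ln A + ln (1 - x)" "ln (A * (1 + x)) = ln A + ln (1 + x)"
          using \<open>0 < A\<close> \<open>0 < x\<close> \<open>x < 1\<close> by (simp_all add: ln_mult_pos)
        show ?thesis
          unfolding ab eqs by algebra
      qed
      moreover have "A * ((1 + x) * ln (1 + x) - (1 - x) * ln (1 - x)) = (b - a) * L"
        unfolding L_def ab using \<open>0 < x\<close> by (simp add: field_simps)
      ultimately have "b * ln b - a * ln a = (b - a) * (ln A + L)"
        by (simp add: distrib_left)
      then show ?thesis using that by simp
    qed
    then have "identric_mean a b = exp (ln A + (L - 1))"
      using that by (simp add: identric_mean_eq_exp)
    also have "\<dots> \<le> exp (ln A - p)"
      using ln_identric_le[OF \<open>0 < x\<close> \<open>x < 1\<close>, of 512] by (simp add: L_def p_def)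
    also have "\<dots> = A * exp (- p)"
      using \<open>0 < A\<close> by (simp add: exp_diff exp_minus divide_inverse)
    also have "\<dots> \<le> A * (g2 / g1)"
    proof -
      have "g1 \<le> exp p * g2"
        unfolding g1_def g2_def p_def using \<open>0 < x\<close> \<open>x < 1\<close>
        by (intro gap_ratio_exp_le) (auto simp: power_less_one_iff)
      then have "exp (- p) * g1 \<le> g2"
        by (simp add: exp_minus field_simps)
      then show ?thesis using \<open>0 < A\<close> \<open>0 < g1\<close> by (simp add: pos_le_divide_eq)
    qed
    also have "\<dots> = lambda_mean (209 / 201) a b" by (rule lambda[symmetric])
    finally show ?thesis .
  qed
  show ?thesis
  proof (cases a b rule: linorder_cases)
    case greater
    then show ?thesis
      using less[of b a] assms identric_mean_commute[OF assms] lambda_mean_commute[OF assms] by simp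
  qed (use assms less in \<open>auto simp: identric_mean_def lambda_mean_def\<close>)
qed

text \<open>With \<open>b = 1\<close> and \<open>a\<close> tending to 0, the lambda mean tends to
  \<open>L < exp (- 1)\<close>, while \<open>a * ln a \<le> 0\<close> keeps the identric mean at
  least \<open>exp (- 1)\<close>.\<close>

lemma exists_lambda_mean_less_identric_mean:
  "\<exists>a b. 0 < a \<and> 0 < b \<and> lambda_mean 1.03 a b < identric_mean a b"
proof -
  define s :: real where "s = 1.03"
  define c where "c = (2::real) powr 0.03"
  \<comment> \<open>The limit \<open>L\<close> decreases in \<open>c\<close>, so a lower bound is
    needed; it follows from \<open>c ^ 100 = 8\<close>.\<close>
  have "1.021 \<le> c"
  proof (rule power_le_imp_le_base)
    have "(1.021 ^ 10) ^ 10 \<le> (1.2311 ^ 10 :: real)"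
      by (intro power_mono) (simp_all add: power_divide)
    also have "\<dots> \<le> 8" by (simp add: power_divide)
    also have "8 = c ^ 100" by (simp add: c_def powr_powr flip: powr_realpow)
    finally show "1.021 ^ Suc 99 \<le> c ^ Suc 99" by (simp flip: power_mult)
  qed (simp add: c_def)
  have half: "(1 / 2) powr s = 1 / (2 * c)" "(1 / 2) powr (s + 1) = 1 / (4 * c)"
    using powr_add[of 2 1 "0.03 :: real"] powr_add[of 2 2 "0.03 :: real"]
    by (simp_all add: powr_divide s_def c_def)
  define F where "F = (\<lambda>a::real. (s - 1) / (s + 1) *
       ((a powr (s + 1) + 1 powr (s + 1) - 2 * ((a + 1) / 2) powr (s + 1)) /
        (a powr s + 1 powr s - 2 * ((a + 1) / 2) powr s)))"
  define L where "L = (s - 1) / (s + 1) * ((1 - 1 / (2 * c)) / (1 - 1 / c))"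
  have pos: "\<forall>\<^sub>F a in at_right 0. 0 < (a::real) \<and> a < 1"
    by (auto simp: eventually_at_right_field intro!: exI[of _ 1])
  then have "\<forall>\<^sub>F a in at_right 0. 0 \<le> (a::real)" by eventually_elim simp
  then have "(F \<longlongrightarrow> (s - 1) / (s + 1) *
       ((0 powr (s + 1) + 1 powr (s + 1) - 2 * ((0 + 1) / 2) powr (s + 1)) /
        (0 powr s + 1 powr s - 2 * ((0 + 1) / 2) powr s))) (at_right 0)"
    unfolding F_def using \<open>1.021 \<le> c\<close> half
    by (intro tendsto_intros tendsto_powr') (auto simp: s_def)
  then have "(F \<longlongrightarrow> L) (at_right 0)"
    using half by (simp add: L_def)
  moreover have "L < exp (- 1)"
  proof -
    have "L = 3 / 203 * ((c - 1 / 2) / (c - 1))"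
      using \<open>1.021 \<le> c\<close> by (simp add: L_def s_def divide_simps)
    also have "\<dots> < 1 / 2.72"
      using \<open>1.021 \<le> c\<close> by (simp add: divide_simps)
    also have "\<dots> \<le> 1 / exp 1"
      using e_less_272 by (intro divide_left_mono) auto
    finally show ?thesis by (simp add: exp_minus divide_inverse)
  qed
  ultimately have "\<forall>\<^sub>F a in at_right 0. F a < exp (- 1)"
    by (rule order_tendstoD)
  with pos have "\<forall>\<^sub>F a in at_right 0. 0 < a \<and> a < 1 \<and> F a < exp (- 1)"
    by eventually_elim auto
  then obtain a where a: "0 < a" "a < 1" "F a < exp (- 1)"
    using eventually_happens'[OF trivial_limit_at_right_real] by blast
  have "lambda_mean s a 1 = F a"
    using a by (simp add: lambda_mean_def F_def s_def)
  also have "F a < exp (- 1)" by fact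
  also have "exp (- 1) \<le> identric_mean a 1"
  proof -
    have "a * ln a \<le> 0" using a by (simp add: mult_nonneg_nonpos)
    then show ?thesis using a by (simp add: identric_mean_eq_exp divide_nonpos_pos)
  qed
  finally show ?thesis using a unfolding s_def by (intro exI[of _ a] exI[of _ 1]) auto
qed

section \<open>The threshold exponent\<close>

lemma tendsto_lambda_mean:
  assumes "0 < a" "0 < b" "1 < s"
  shows "((\<lambda>r. lambda_mean r a b) \<longlongrightarrow> lambda_mean s a b) (at_right s)"
proof (cases "a = b")
  case False
  \<comment> \<open>For \<open>r > 1\<close> neither \<open>r\<close> nor \<open>r + 1\<close> is an
    exceptional exponent, so one closed form, continuous in \<open>r\<close>, covers both
    gaps.\<close>
  define G where "G = (\<lambda>r. a powr r / (r * (r - 1)) + b powr r / (r * (r - 1)) - 2 * (((a + b) / 2) powr r / (r * (r - 1))))"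
  have G: "jensen_gap r a b = G r" if "1 < r" for r
    using that by (simp add: jensen_gap_def pow_convex_def G_def)
  have tendsto: "(G \<longlongrightarrow> G r) (at r within T)" if "1 < r" for r T
    unfolding G_def using assms that by (intro tendsto_intros) auto
  have "((\<lambda>r. G (r + 1) / G r) \<longlongrightarrow> G (s + 1) / G s) (at_right s)"
  proof (intro tendsto_divide tendsto)
    show "((\<lambda>r. G (r + 1)) \<longlongrightarrow> G (s + 1)) (at_right s)"
      unfolding G_def using assms by (intro tendsto_intros) auto
    show "G s \<noteq> 0"
      using jensen_gap_pos[OF assms(1,2) False, of s] assms(3) by (simp add: G)
  qed (use assms in auto)
  moreover have "\<forall>\<^sub>F r in at_right s. lambda_mean r a b = G (r + 1) / G r"
    using eventually_at_right_less[of s]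
  proof eventually_elim
    case (elim r)
    then show ?case using assms by (simp add: lambda_mean_eq_jensen_gap[OF assms(1,2) False] G)
  qed
  ultimately show ?thesis
    using assms by (simp add: lambda_mean_eq_jensen_gap[OF assms(1,2) False] G tendsto_cong)
qed (simp add: lambda_mean_def)

theorem theorem3:
  shows "\<exists>s1::real. 1.03 < s1 \<and> s1 < 1.04 \<and>
    (\<forall>s. s1 \<le> s \<and> s \<le> 2 \<longrightarrow>
       (\<forall>a b. 0 < a \<and> 0 < b \<longrightarrow>
          identric_mean a b \<le> lambda_mean s a b \<and> lambda_mean s a b \<le> arith_mean a b)) \<and>
    (\<forall>s. (\<forall>a b. 0 < a \<and> 0 < b \<longrightarrow> identric_mean a b \<le> lambda_mean s a b) \<longleftrightarrow> s1 \<le> s) \<and>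
    (\<forall>s. (\<forall>a b. 0 < a \<and> 0 < b \<longrightarrow> lambda_mean s a b \<le> arith_mean a b) \<longleftrightarrow> s \<le> 2)"
proof -
  define S where "S = {s. \<forall>a b. 0 < a \<and> 0 < b \<longrightarrow> identric_mean a b \<le> lambda_mean s a b}"
  define s1 where "s1 = Inf S"
  have up: "r \<in> S" if "s \<in> S" "s \<le> r" for r s
    using that lambda_mean_mono unfolding S_def by (blast intro: order_trans)
  have "209 / 201 \<in> S" by (simp add: S_def identric_mean_le_lambda_mean_209_201)
  have "1.03 \<notin> S"
    using exists_lambda_mean_less_identric_mean unfolding S_def by (auto simp: not_le)
  then have lower: "1.03 \<le> s" if "s \<in> S" for s
    using up that by (meson linear)
  then have "bdd_below S" by (rule bdd_belowI)
  then have "s1 \<le> 209 / 201"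
    unfolding s1_def using \<open>209 / 201 \<in> S\<close> by (rule cInf_lower[rotated])
  have "1.03 \<le> s1"
    unfolding s1_def using \<open>209 / 201 \<in> S\<close> lower by (intro cInf_greatest) auto
  have above: "r \<in> S" if "s1 < r" for r
    using that \<open>bdd_below S\<close> \<open>209 / 201 \<in> S\<close> up unfolding s1_def
    by (metis cInf_less_iff empty_iff less_imp_le)
  \<comment> \<open>The inequality holds for every \<open>r > s1\<close> and passes to the
    right-hand limit; \<open>1.03 \<le> s1\<close> supplies \<open>1 < s1\<close>.\<close>
  have "s1 \<in> S"
    unfolding S_def
  proof (intro CollectI allI impI)
    fix a b :: real assume ab: "0 < a \<and> 0 < b"
    have "\<forall>\<^sub>F r in at_right s1. identric_mean a b \<le> lambda_mean r a b"
      using eventually_at_right_less[of s1]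
      by eventually_elim (use above ab in \<open>auto simp: S_def\<close>)
    then show "identric_mean a b \<le> lambda_mean s1 a b"
      using tendsto_lambda_mean[of a b s1] ab \<open>1.03 \<le> s1\<close>
      by (intro tendsto_lowerbound[OF _ _ trivial_limit_at_right_real]) auto
  qed
  then have S: "s \<in> S \<longleftrightarrow> s1 \<le> s" for s
    using up \<open>bdd_below S\<close> by (auto simp: s1_def intro: cInf_lower)
  have "s1 \<noteq> 1.03" using \<open>s1 \<in> S\<close> \<open>1.03 \<notin> S\<close> by metis
  have arith: "(\<forall>a b. 0 < a \<and> 0 < b \<longrightarrow> lambda_mean s a b \<le> arith_mean a b) \<longleftrightarrow> s \<le> 2" for s
    using lambda_mean_le_arith_mean exists_lambda_mean_gt_arith_mean[of s]
    by (meson not_le)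
  show ?thesis
  proof (intro exI[of _ s1] conjI allI impI)
    show "1.03 < s1" using \<open>1.03 \<le> s1\<close> \<open>s1 \<noteq> 1.03\<close> by simp
    show "s1 < 1.04" using \<open>s1 \<le> 209 / 201\<close> by simp
  qed (use S arith in \<open>auto simp: S_def intro: lambda_mean_le_arith_mean\<close>)
qed

end
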